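(* For every integer $n_0$ there exist an integer $n \ge n_0$ divisible by $3$ and a $3$-graph $H$ of order $n$ without isolated vertex such that: (1) $\sigma_2(H) > 2\left(\binom{n-1}{2}-\binom{2n/3}{2}\right)$; (2) $H$ does not contain a perfect matching; (3) $H$ is not a subgraph of $H^2_{n,n/3}$.
   Context: A $3$-graph $H$ is a pair $(V(H),E(H))$ with $V(H)$ a finite set and $E(H)$ a family of $3$-element subsets of $V(H)$; its order is $|V(H)|$. The degree $\deg(u)$ of a vertex $u$ is the number of edges containing $u$; $u$ is isolated if $\deg(u)=0$. Two distinct vertices are adjacent if some edge contains both of them. $\sigma_2(H)$ denotes the minimum of $\deg(u)+\deg(v)$ over all pairs of adjacent vertices $u,v$ of $H$. A matching is a family of pairwise disjoint edges; it is perfect if it covers all the vertices of $H$. For $n$ divisible by $3$, $H^2_{n,n/3}$ is the $3$-graph of order $n$ whose vertex set is partitioned into two sets $S$ and $T$ of sizes $\frac{n}{3}+1$ and $\frac{2n}{3}-1$, respectively, and whose edge set consists of all triples with at least $2$ vertices in $T$. "$H$ is a subgraph of $H^2_{n,n/3}$" means that $H$ is isomorphic to a subgraph of $H^2_{n,n/3}$, i.e. there is an injection $V(H)\to V(H^2_{n,n/3})$ mapping every edge of $H$ to an edge of $H^2_{n,n/3}$. *)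

theory Defs
  imports Complex_Main
begin

record 'a hgraph =
  verts :: "'a set"
  edges :: "'a set set"

definition three_graph :: "'a hgraph \<Rightarrow> bool" where
  "three_graph H \<longleftrightarrow> finite (verts H) \<and> (\<forall>e\<in>edges H. e \<subseteq> verts H \<and> card e = 3)"

definition hgraph_order :: "'a hgraph \<Rightarrow> nat" where
  "hgraph_order H = card (verts H)"

definition deg :: "'a hgraph \<Rightarrow> 'a \<Rightarrow> nat" where
  "deg H u = card {e \<in> edges H. u \<in> e}"

definition isolated_vertex :: "'a hgraph \<Rightarrow> 'a \<Rightarrow> bool" where
  "isolated_vertex H u \<longleftrightarrow> u \<in> verts H \<and> deg H u = 0"

definition adjacent :: "'a hgraph \<Rightarrow> 'a \<Rightarrow> 'a \<Rightarrow> bool" where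
  "adjacent H u v \<longleftrightarrow> u \<noteq> v \<and> (\<exists>e\<in>edges H. u \<in> e \<and> v \<in> e)"

(* Unspecified if H has no edge; a nonempty 3-graph without isolated vertex has adjacent pairs. *)
definition sigma2 :: "'a hgraph \<Rightarrow> nat" where
  "sigma2 H = Min {deg H u + deg H v | u v. adjacent H u v}"

definition matching :: "'a hgraph \<Rightarrow> 'a set set \<Rightarrow> bool" where
  "matching H M \<longleftrightarrow> M \<subseteq> edges H \<and> pairwise disjnt M"

definition perfect_matching :: "'a hgraph \<Rightarrow> 'a set set \<Rightarrow> bool" where
  "perfect_matching H M \<longleftrightarrow> matching H M \<and> \<Union>M = verts H"

(* The graph H^2_{n,n/3}, for n > 0 divisible by 3, with S = {..<n div 3 + 1} and
   T = {n div 3 + 1..<n}, so that card T = 2 * n div 3 - 1. *)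
definition H2 :: "nat \<Rightarrow> nat hgraph" where
  "H2 n = \<lparr> verts = {..<n},
            edges = {e. e \<subseteq> {..<n} \<and> card e = 3 \<and> card (e \<inter> {n div 3 + 1..<n}) \<ge> 2} \<rparr>"

(* Subgraph up to isomorphism. *)
definition subgraph_of :: "'a hgraph \<Rightarrow> 'b hgraph \<Rightarrow> bool" where
  "subgraph_of H G \<longleftrightarrow>
     (\<exists>f. inj_on f (verts H) \<and> f ` verts H \<subseteq> verts G \<and> (\<forall>e\<in>edges H. f ` e \<in> edges G))"

end

theory Submission
  imports Defs
begin

text \<open>
  The threshold in the theorem is the one met by pairs of \<open>B\<close>-vertices in the extremal graph
  in which \<open>A\<close> has \<open>n/3 - 1\<close> vertices, \<open>B\<close> is the rest, and the edges are the triples that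
  meet \<open>A\<close>: a matching there has at most \<open>card A\<close> edges. The counterexample
  enlarges \<open>A\<close> and adds a third part \<open>S\<close> of vertices of low degree which consume the vertices of \<open>A\<close> two at a time: a triple is
  an edge if it has strictly more vertices in \<open>A\<close> than in \<open>S\<close>, which leaves the types
  \<open>SAA\<close>, \<open>AAA\<close>, \<open>AAB\<close> and \<open>ABB\<close>.

  There is no perfect matching because of a weight argument: give the vertices of \<open>A\<close>, \<open>B\<close>, \<open>S\<close>
  the weights \<open>1\<close>, \<open>0\<close>, \<open>-1\<close>. Every edge has weight at least \<open>1\<close>, so a perfect matching, which
  has \<open>n/3\<close> edges, requires \<open>card A - card S \<ge> n/3\<close>; the sizes are chosen with
  \<open>card A - card S = n/3 - 1\<close> (lemma \<open>no_perfect_matching\<close>).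

  A vertex of \<open>S\<close> is adjacent to vertices of \<open>A\<close> only (lemma \<open>neighbour_of_S\<close>), and those have
  large degree. Write \<open>card S = x n/3\<close>. Up to terms linear in \<open>n\<close> and in units of \<open>(n/3)\<^sup>2\<close>, the
  threshold is \<open>5\<close>, the degree sum over a pair in \<open>S \<times> A\<close> is \<open>5 - x + 2 x\<^sup>2\<close>, and over a pair in
  \<open>B\<close> it is \<open>5 + 2 x - 3 x\<^sup>2\<close>. Both exceed \<open>5\<close> exactly for \<open>1/2 < x < 2/3\<close>. The choice
  \<open>x = 3/5\<close> gives \<open>n = 15 k\<close> and parts of sizes \<open>3 k\<close>, \<open>8 k - 1\<close> and \<open>4 k + 1\<close>.

  Finally, a subgraph of \<open>H\<^sup>2\<close> of the same order has \<open>n/3 + 1\<close> pairwise nonadjacent vertices, namely those mapped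
  into the part that every edge meets at most once (lemma \<open>subgraph_of_H2_independent\<close>). In the graph
  above, such a set consists of a single vertex of \<open>A\<close>, or of vertices of \<open>S\<close> and at most one vertex
  of \<open>B\<close>, so it has at most \<open>3 k + 1\<close> elements (lemma \<open>independent_card_le\<close>).
\<close>

section \<open>Degrees, sums over adjacent pairs, and subgraphs of \<open>H\<^sup>2\<close>\<close>

lemma finite_edges: "three_graph H \<Longrightarrow> finite (edges H)"
  by (rule finite_subset[of _ "Pow (verts H)"]) (auto simp: three_graph_def)

lemma deg_ge_card_link:
  assumes "three_graph H"
    and "\<And>p. p \<in> P \<Longrightarrow> u \<notin> p \<and> insert u p \<in> edges H"
  shows "card P \<le> deg H u"
  unfolding deg_def
proof (rule card_inj_on_le)
  show "inj_on (insert u) P"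
    using assms(2) by (intro inj_onI) (metis insert_ident)
  show "insert u ` P \<subseteq> {e \<in> edges H. u \<in> e}"
    using assms(2) by auto
  show "finite {e \<in> edges H. u \<in> e}"
    using finite_edges[OF assms(1)] by simp
qed

lemma less_sigma2:
  assumes H: "three_graph H" and ex: "\<exists>u v. adjacent H u v"
    and less: "\<And>u v. adjacent H u v \<Longrightarrow> t < deg H u + deg H v"
  shows "t < sigma2 H"
proof -
  let ?D = "{deg H u + deg H v | u v. adjacent H u v}"
  have "?D \<subseteq> (\<lambda>(u, v). deg H u + deg H v) ` (verts H \<times> verts H)"
  proof
    fix d assume "d \<in> ?D"
    then obtain u v where d: "d = deg H u + deg H v" and "adjacent H u v" by blast
    then have "u \<in> verts H" "v \<in> verts H"
      using H by (auto simp: adjacent_def three_graph_def)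
    then show "d \<in> (\<lambda>(u, v). deg H u + deg H v) ` (verts H \<times> verts H)"
      using d by (auto intro!: image_eqI[where x = "(u, v)"])
  qed
  then have "finite ?D"
    by (rule finite_subset) (use H in \<open>simp add: three_graph_def\<close>)
  moreover have "?D \<noteq> {}" using ex by blast
  ultimately show ?thesis
    unfolding sigma2_def using less by auto
qed

text \<open>
  As the orders agree, the embedding is onto, so the preimage of \<open>{..n div 3}\<close> has full size. It
  is independent because every edge of \<open>H2 n\<close> meets \<open>{..n div 3}\<close> at most once.
\<close>

lemma subgraph_of_H2_independent:
  assumes H: "three_graph H" and n: "card (verts H) = n" "0 < n"
    and sub: "subgraph_of H (H2 n)"
  shows "\<exists>I \<subseteq> verts H. card I = n div 3 + 1 \<and> (\<forall>u\<in>I. \<forall>v\<in>I. \<not> adjacent H u v)"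
proof -
  obtain f where inj: "inj_on f (verts H)" and into: "f ` verts H \<subseteq> {..<n}"
    and hom: "\<And>e. e \<in> edges H \<Longrightarrow> f ` e \<in> edges (H2 n)"
    using sub unfolding subgraph_of_def by (auto simp: H2_def)
  have onto: "f ` verts H = {..<n}"
    using into by (rule card_subset_eq[rotated]) (simp_all add: card_image inj n)
  let ?I = "{v \<in> verts H. f v < n div 3 + 1}"
  have "f ` ?I = {..<n div 3 + 1}"
  proof
    show "{..<n div 3 + 1} \<subseteq> f ` ?I"
    proof
      fix y assume y: "y \<in> {..<n div 3 + 1}"
      have "n div 3 + 1 \<le> n" using n(2) by simp
      then have "y \<in> f ` verts H" using y onto by auto
      then show "y \<in> f ` ?I" using y by auto
    qed
  qed auto
  moreover have "card (f ` ?I) = card ?I"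
    by (rule card_image) (rule inj_on_subset[OF inj], auto)
  ultimately have "card ?I = n div 3 + 1" by simp
  moreover have "\<not> adjacent H u v" if "u \<in> ?I" "v \<in> ?I" for u v
  proof
    assume "adjacent H u v"
    then obtain e where e: "e \<in> edges H" "u \<in> e" "v \<in> e" and "u \<noteq> v"
      by (auto simp: adjacent_def)
    then have uv: "f u \<noteq> f v" using inj that by (auto dest: inj_onD)
    let ?e = "f ` e" and ?T = "{n div 3 + 1..<n}"
    have e3: "card ?e = 3" and T: "2 \<le> card (?e \<inter> ?T)" and fin: "finite ?e"
      using hom[OF e(1)] by (auto simp: H2_def intro: card_ge_0_finite)
    have "card ({f u, f v} \<union> (?e \<inter> ?T)) = card {f u, f v} + card (?e \<inter> ?T)"
      using that fin by (intro card_Un_disjoint) auto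
    moreover have "card ({f u, f v} \<union> (?e \<inter> ?T)) \<le> card ?e"
      using e fin by (intro card_mono) auto
    ultimately show False using e3 T uv by simp
  qed
  ultimately show ?thesis by (intro exI[of _ ?I]) auto
qed

section \<open>Triples with more vertices in \<open>A\<close> than in \<open>S\<close>\<close>

locale three_parts =
  fixes S A B :: "'a set"
  assumes fin: "finite S" "finite A" "finite B"
    and disj: "S \<inter> A = {}" "S \<inter> B = {}" "A \<inter> B = {}"
begin

definition G :: "'a hgraph" where
  "G = \<lparr> verts = S \<union> A \<union> B,
         edges = {e. e \<subseteq> S \<union> A \<union> B \<and> card e = 3 \<and> card (e \<inter> S) < card (e \<inter> A)} \<rparr>"

lemma three_graph_G: "three_graph G"
  using fin by (auto simp: three_graph_def G_def)

lemma card_verts_G: "card (verts G) = card S + card A + card B"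
proof -
  have "card (S \<union> A \<union> B) = card (S \<union> A) + card B"
    using fin disj by (intro card_Un_disjoint) auto
  then show ?thesis
    using fin disj by (simp add: G_def card_Un_disjoint)
qed

lemma edge_AA:
  assumes "a \<in> A" "a' \<in> A" "a \<noteq> a'" "v \<in> S \<union> A \<union> B" "v \<noteq> a" "v \<noteq> a'"
  shows "{a, a', v} \<in> edges G"
proof -
  let ?e = "{a, a', v}"
  have "card (?e \<inter> S) \<le> card {v}"
    using assms disj by (intro card_mono) auto
  moreover have "card {a, a'} \<le> card (?e \<inter> A)"
    using assms by (intro card_mono) auto
  ultimately show ?thesis using assms by (auto simp: G_def)
qed

lemma edge_A_avoiding_S:
  assumes "a \<in> A" "v \<in> A \<union> B" "w \<in> A \<union> B" "a \<noteq> v" "a \<noteq> w" "v \<noteq> w"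
  shows "{a, v, w} \<in> edges G"
proof -
  let ?e = "{a, v, w}"
  have "?e \<inter> S = {}" using assms disj by auto
  moreover have "0 < card (?e \<inter> A)"
    using assms by (auto simp: card_gt_0_iff)
  ultimately show ?thesis using assms by (auto simp: G_def)
qed

lemma neighbour_of_S:
  assumes "adjacent G s v" "s \<in> S"
  shows "v \<in> A"
proof (rule ccontr)
  assume v: "v \<notin> A"
  obtain e where e: "s \<in> e" "v \<in> e" "s \<noteq> v" "card e = 3" "card (e \<inter> S) < card (e \<inter> A)"
    using assms by (auto simp: adjacent_def G_def)
  have fe: "finite e" using e(4) by (simp add: card_ge_0_finite)
  have "card {s} \<le> card (e \<inter> S)"
    using assms e fe by (intro card_mono) auto
  then have "2 \<le> card (e \<inter> A)" using e(5) by simp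
  moreover have "card ({s, v} \<union> (e \<inter> A)) = card {s, v} + card (e \<inter> A)"
    using assms v fe disj by (intro card_Un_disjoint) auto
  moreover have "card ({s, v} \<union> (e \<inter> A)) \<le> card e"
    using e fe by (intro card_mono) auto
  ultimately show False using e by simp
qed

lemma adjacent_A:
  assumes "a \<in> A" "v \<in> S \<union> A \<union> B" "v \<noteq> a" "3 \<le> card A"
  shows "adjacent G a v"
proof -
  have "\<not> A \<subseteq> {a, v}"
    using assms card_mono[of "{a, v}" A] by auto
  then obtain a' where "a' \<in> A" "a' \<noteq> a" "a' \<noteq> v" by auto
  then have "{a, a', v} \<in> edges G" using assms by (intro edge_AA) auto
  then show ?thesis
    unfolding adjacent_def using assms(3) by (intro conjI bexI[of _ "{a, a', v}"]) auto
qed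

lemma adjacent_B:
  assumes "b \<in> B" "b' \<in> B" "b \<noteq> b'" "A \<noteq> {}"
  shows "adjacent G b b'"
proof -
  obtain a where a: "a \<in> A" using assms(4) by auto
  have "{a, b, b'} \<in> edges G" using a assms disj by (intro edge_A_avoiding_S) auto
  then show ?thesis
    unfolding adjacent_def using assms(3) by (intro conjI bexI[of _ "{a, b, b'}"]) auto
qed

lemma independent_card_le:
  assumes I: "I \<subseteq> S \<union> A \<union> B" and indep: "\<And>u v. u \<in> I \<Longrightarrow> v \<in> I \<Longrightarrow> \<not> adjacent G u v"
    and "3 \<le> card A"
  shows "card I \<le> card S + 1"
proof (cases "I \<inter> A = {}")
  case False
  then obtain a where a: "a \<in> I" "a \<in> A" by auto
  then have "I \<subseteq> {a}" using adjacent_A[of a] I indep assms(3) by blast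
  then have "card I \<le> card {a}" by (intro card_mono) auto
  then show ?thesis by simp
next
  case True
  have A: "A \<noteq> {}" using assms(3) by auto
  have "card (I \<inter> B) \<le> Suc 0"
    using fin adjacent_B[OF _ _ _ A] indep by (subst card_le_Suc0_iff_eq) blast+
  moreover have "card (I \<inter> S) \<le> card S" using fin by (intro card_mono) auto
  moreover have "card I \<le> card (I \<inter> S) + card (I \<inter> B)"
  proof -
    have "I = (I \<inter> S) \<union> (I \<inter> B)" using I True by auto
    then show ?thesis using card_Un_le[of "I \<inter> S" "I \<inter> B"] by simp
  qed
  ultimately show ?thesis by simp
qed

text \<open>
  Double counting of the weight that is \<open>1\<close> on \<open>A\<close>, \<open>-1\<close> on \<open>S\<close> and \<open>0\<close> on \<open>B\<close>, with the
  negative part moved to the other side: each of the \<open>card M\<close> edges contributes at least \<open>1\<close>.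
\<close>

lemma no_perfect_matching:
  assumes "3 * card A < 3 * card S + card (verts G)"
  shows "\<not> perfect_matching G M"
proof
  assume "perfect_matching G M"
  then have M: "M \<subseteq> edges G" and pw: "pairwise disjnt M" and cover: "\<Union>M = S \<union> A \<union> B"
    by (auto simp: perfect_matching_def matching_def G_def)
  have finM: "finite M"
    using M finite_edges[OF three_graph_G] by (rule finite_subset)
  have e3: "card e = 3" if "e \<in> M" for e
    using that M by (auto simp: G_def)
  have fe: "finite e" if "e \<in> M" for e
    using e3[OF that] by (simp add: card_ge_0_finite)
  have part: "(\<Sum>e\<in>M. card (e \<inter> X)) = card X" if "X \<subseteq> S \<union> A \<union> B" for X
  proof -
    have "card (\<Union>e\<in>M. e \<inter> X) = (\<Sum>e\<in>M. card (e \<inter> X))"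
      using finM fe pw by (intro card_UN_disjoint) (auto simp: pairwise_def disjnt_def)
    moreover have "(\<Union>e\<in>M. e \<inter> X) = X" using cover that by auto
    ultimately show ?thesis by simp
  qed
  have "card (verts G) = (\<Sum>e\<in>M. card (e \<inter> (S \<union> A \<union> B)))"
    using part[of "S \<union> A \<union> B"] by (simp add: G_def)
  also have "\<dots> = (\<Sum>e\<in>M. 3)"
  proof (rule sum.cong)
    fix e assume "e \<in> M"
    then have "e \<inter> (S \<union> A \<union> B) = e" using cover by auto
    then show "card (e \<inter> (S \<union> A \<union> B)) = 3" using e3[OF \<open>e \<in> M\<close>] by simp
  qed simp
  finally have size: "card (verts G) = 3 * card M" by simp
  have "(\<Sum>e\<in>M. card (e \<inter> S) + 1) \<le> (\<Sum>e\<in>M. card (e \<inter> A))"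
    using M by (intro sum_mono) (auto simp: G_def)
  moreover have "(\<Sum>e\<in>M. card (e \<inter> S)) = card S" "(\<Sum>e\<in>M. card (e \<inter> A)) = card A"
    by (rule part, blast)+
  ultimately have "card S + card M \<le> card A"
    by (simp add: sum_Suc)
  then show False using assms size by simp
qed

lemma deg_S_ge:
  assumes "s \<in> S"
  shows "card A choose 2 \<le> deg G s"
proof -
  have "card {p. p \<subseteq> A \<and> card p = 2} \<le> deg G s"
  proof (rule deg_ge_card_link[OF three_graph_G])
    fix p assume "p \<in> {p. p \<subseteq> A \<and> card p = 2}"
    then obtain a a' where p: "p = {a, a'}" "a \<noteq> a'" "a \<in> A" "a' \<in> A"
      by (auto simp: card_2_iff)
    have "{a, a', s} \<in> edges G" using p assms disj by (intro edge_AA) auto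
    then show "s \<notin> p \<and> insert s p \<in> edges G"
      using p assms disj by (auto simp: insert_commute)
  qed
  then show ?thesis using fin by (simp add: n_subsets)
qed

lemma deg_B_ge:
  assumes "b \<in> B"
  shows "(card A + card B - 1 choose 2) - (card B - 1 choose 2) \<le> deg G b"
proof -
  let ?P = "{p. p \<subseteq> A \<union> (B - {b}) \<and> card p = 2}" and ?Q = "{p. p \<subseteq> B - {b} \<and> card p = 2}"
  have "card ?P = (card A + card B - 1 choose 2)"
  proof -
    have "card (A \<union> (B - {b})) = card A + card (B - {b})"
      using fin disj by (intro card_Un_disjoint) auto
    also have "\<dots> = card A + card B - 1"
      using fin assms by (cases "card B") (auto simp: card_Diff_singleton)
    finally show ?thesis using fin by (simp add: n_subsets)
  qed
  moreover have "card ?Q = (card B - 1 choose 2)"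
    using fin assms by (simp add: n_subsets)
  moreover have "finite ?Q" using fin by simp
  then have "card (?P - ?Q) = card ?P - card ?Q"
    by (intro card_Diff_subset) auto
  moreover have "card (?P - ?Q) \<le> deg G b"
  proof (rule deg_ge_card_link[OF three_graph_G])
    fix p assume p: "p \<in> ?P - ?Q"
    then obtain a where a: "a \<in> p" "a \<in> A" by blast
    from p have "card p = 2" by simp
    with a obtain v where v: "p = {a, v}" "a \<noteq> v"
      by (auto simp: card_2_iff)
    have "{a, v, b} \<in> edges G"
      using v p a assms disj by (intro edge_A_avoiding_S) auto
    then show "b \<notin> p \<and> insert b p \<in> edges G"
      using v p a assms disj by (auto simp: insert_commute)
  qed
  ultimately show ?thesis by simp
qed

lemma deg_A_ge:
  assumes "a \<in> A"
  shows "(card A + card B - 1 choose 2) + card S * (card A - 1) \<le> deg G a"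
proof -
  let ?P = "{p. p \<subseteq> (A - {a}) \<union> B \<and> card p = 2}"
  let ?pair = "\<lambda>(s, a'). {s, a'}"
  let ?Q = "?pair ` (S \<times> (A - {a}))"
  have "card ?P = (card A + card B - 1 choose 2)"
  proof -
    have "card ((A - {a}) \<union> B) = card (A - {a}) + card B"
      using fin disj by (intro card_Un_disjoint) auto
    also have "\<dots> = card A + card B - 1"
      using fin assms by (cases "card A") (auto simp: card_Diff_singleton)
    finally show ?thesis using fin by (simp add: n_subsets)
  qed
  moreover have "card ?Q = card S * (card A - 1)"
  proof -
    have "inj_on ?pair (S \<times> (A - {a}))"
      using disj by (intro inj_onI) (auto simp: doubleton_eq_iff)
    then show ?thesis
      using fin assms by (simp add: card_image card_cartesian_product)
  qed
  moreover have "card (?P \<union> ?Q) = card ?P + card ?Q"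
    using fin disj by (intro card_Un_disjoint) auto
  moreover have "card (?P \<union> ?Q) \<le> deg G a"
  proof (rule deg_ge_card_link[OF three_graph_G])
    fix p assume "p \<in> ?P \<union> ?Q"
    then show "a \<notin> p \<and> insert a p \<in> edges G"
    proof
      assume p: "p \<in> ?P"
      then obtain v w where v: "p = {v, w}" "v \<noteq> w" by (auto simp: card_2_iff)
      have "{a, v, w} \<in> edges G"
        using v p assms disj by (intro edge_A_avoiding_S) auto
      then show ?thesis using v p assms disj by auto
    next
      assume "p \<in> ?Q"
      then obtain s a' where p: "p = {s, a'}" "s \<in> S" "a' \<in> A" "a' \<noteq> a" by auto
      have "{a, a', s} \<in> edges G" using p assms disj by (intro edge_AA) auto
      then show ?thesis using p assms disj by (auto simp: insert_commute)
    qed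
  qed
  ultimately show ?thesis by simp
qed

text \<open>
  Only pairs in \<open>S \<times> A\<close> and in \<open>B\<close> can be critical for the minimal degree sum, as soon as every
  vertex of \<open>A\<close> has at least the degree bound required in \<open>B\<close>.
\<close>

lemma degree_sum_adjacent:
  assumes adj: "adjacent G u v"
    and S: "\<And>s. s \<in> S \<Longrightarrow> dS \<le> deg G s"
    and A: "\<And>a. a \<in> A \<Longrightarrow> dA \<le> deg G a"
    and B: "\<And>b. b \<in> B \<Longrightarrow> dB \<le> deg G b"
    and t: "t < dS + dA" "t < 2 * dB" and "dB \<le> dA"
  shows "t < deg G u + deg G v"
proof -
  have "adjacent G v u" using adj by (auto simp: adjacent_def)
  then have SA: "u \<in> S \<Longrightarrow> v \<in> A" "v \<in> S \<Longrightarrow> u \<in> A"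
    using adj neighbour_of_S by blast+
  have uv: "u \<in> S \<union> A \<union> B" "v \<in> S \<union> A \<union> B"
    using adj by (auto simp: adjacent_def G_def)
  have ge: "dB \<le> deg G w" if "w \<in> A \<union> B" for w
    using that A B \<open>dB \<le> dA\<close> le_trans by blast
  consider "u \<in> S" "v \<in> A" | "v \<in> S" "u \<in> A" | "u \<in> A \<union> B" "v \<in> A \<union> B"
    using uv SA by blast
  then show ?thesis
  proof cases
    case 1
    then show ?thesis using S[of u] A[of v] t by linarith
  next
    case 2
    then show ?thesis using S[of v] A[of u] t by linarith
  next
    case 3
    then show ?thesis using ge[of u] ge[of v] t by linarith
  qed
qed

end

section \<open>Sizes \<open>3 k\<close>, \<open>8 k - 1\<close> and \<open>4 k + 1\<close>\<close>

lemma int_choose_two: "int (m choose 2) * 2 = int m * (int m - 1)"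
proof (induction m)
  case (Suc m)
  then show ?case by (simp add: numeral_2_eq_2 algebra_simps)
qed simp

theorem theorem5:
  fixes n0 :: int
  shows "\<exists>(n::nat) (H :: nat hgraph).
    int n \<ge> n0 \<and> 3 dvd n \<and>
    three_graph H \<and> hgraph_order H = n \<and> (\<forall>u\<in>verts H. \<not> isolated_vertex H u) \<and>
    int (sigma2 H) > 2 * (int ((n - 1) choose 2) - int ((2 * n div 3) choose 2)) \<and>
    \<not> (\<exists>M. perfect_matching H M) \<and>
    \<not> subgraph_of H (H2 n)"
proof -
  define k where "k = nat n0 + 1"
  define n where "n = 15 * k"
  have k: "1 \<le> k" by (simp add: k_def)
  define S A B where "S = {..<3 * k}" and "A = {3 * k..<11 * k - 1}" and "B = {11 * k - 1..<15 * k}"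
  interpret three_parts S A B
    using k by unfold_locales (auto simp: S_def A_def B_def)
  have cards: "card S = 3 * k" "card A = 8 * k - 1" "card B = 4 * k + 1"
    using k by (auto simp: S_def A_def B_def)
  have n: "card (verts G) = n"
    using k by (simp add: card_verts_G cards n_def)
  define dS dA dB where "dS = (8 * k - 1 choose 2)"
    and "dA = (12 * k - 1 choose 2) + 3 * k * (8 * k - 2)"
    and "dB = (12 * k - 1 choose 2) - (4 * k choose 2)"
  have S: "dS \<le> deg G s" if "s \<in> S" for s
    using deg_S_ge[OF that] by (simp add: cards dS_def)
  have m: "8 * k - 1 + (4 * k + 1) - 1 = 12 * k - 1" "8 * k - 1 - 1 = 8 * k - 2" by simp_all
  have A: "dA \<le> deg G a" if "a \<in> A" for a
    using deg_A_ge[OF that] unfolding cards dA_def m .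
  have B: "dB \<le> deg G b" if "b \<in> B" for b
    using deg_B_ge[OF that] unfolding cards dB_def m by simp
  have dS: "int dS = 32 * (int k)\<^sup>2 - 12 * int k + 1"
    using int_choose_two[of "8 * k - 1"] k
    by (simp add: dS_def algebra_simps power2_eq_square)
  have dA: "int dA = 96 * (int k)\<^sup>2 - 24 * int k + 1"
  proof -
    have "int dA = int (12 * k - 1 choose 2) + 3 * int k * (8 * int k - 2)"
      using k by (simp add: dA_def)
    then show ?thesis
      using int_choose_two[of "12 * k - 1"] k
      by (simp add: algebra_simps power2_eq_square)
  qed
  have "(4 * k choose 2) \<le> (12 * k - 1 choose 2)"
    using k by (intro binomial_right_mono) simp
  then have dB: "int dB = 64 * (int k)\<^sup>2 - 16 * int k + 1"
    using int_choose_two[of "12 * k - 1"] int_choose_two[of "4 * k"] k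
    by (simp add: dB_def of_nat_diff algebra_simps power2_eq_square)
  define t where "t = 2 * (int ((n - 1) choose 2) - int ((2 * n div 3) choose 2))"
  have "2 * n div 3 = 10 * k" by (simp add: n_def)
  then have t: "t = 125 * (int k)\<^sup>2 - 35 * int k + 2"
    using int_choose_two[of "n - 1"] int_choose_two[of "10 * k"] k
    by (simp add: t_def n_def algebra_simps power2_eq_square)
  have k2: "int k \<le> (int k)\<^sup>2"
    using k by (simp add: power2_eq_square)
  have "dB \<le> dA" "0 < dS" "0 < dB"
    using dS dA dB k2 k by linarith+
  have "0 \<le> t" using t k2 k by linarith
  have adj: "\<exists>u v. adjacent G u v"
  proof -
    have "3 * k \<in> A" "0 \<in> S \<union> A \<union> B" "0 \<noteq> 3 * k" "3 \<le> card A"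
      using k by (auto simp: S_def A_def)
    then show ?thesis using adjacent_A by blast
  qed
  have "nat t < sigma2 G"
  proof (rule less_sigma2[OF three_graph_G adj])
    fix u v assume "adjacent G u v"
    then show "nat t < deg G u + deg G v"
    proof (rule degree_sum_adjacent[OF _ S A B])
      show "nat t < dS + dA" "nat t < 2 * dB"
        using t dS dA dB k2 k \<open>0 \<le> t\<close> by linarith+
    qed (use \<open>dB \<le> dA\<close> in auto)
  qed
  then have "t < int (sigma2 G)" using \<open>0 \<le> t\<close> by linarith
  moreover have "\<not> isolated_vertex G u" if "u \<in> verts G" for u
  proof -
    have "u \<in> S \<union> A \<union> B" using that by (simp add: G_def)
    then have "0 < deg G u"
      using S[of u] A[of u] B[of u] \<open>dB \<le> dA\<close> \<open>0 < dS\<close> \<open>0 < dB\<close> by fastforce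
    then show ?thesis by (simp add: isolated_vertex_def)
  qed
  moreover have "\<not> perfect_matching G M" for M
    using k by (intro no_perfect_matching) (simp add: n cards n_def)
  moreover have "\<not> subgraph_of G (H2 n)"
  proof
    assume sub: "subgraph_of G (H2 n)"
    have "0 < n" using k by (simp add: n_def)
    from subgraph_of_H2_independent[OF three_graph_G n this sub]
    obtain I where I: "I \<subseteq> S \<union> A \<union> B" "card I = n div 3 + 1"
      and "\<And>u v. u \<in> I \<Longrightarrow> v \<in> I \<Longrightarrow> \<not> adjacent G u v"
      by (auto simp: G_def)
    then have "card I \<le> card S + 1"
      using k by (intro independent_card_le) (simp_all add: cards)
    then show False using I k by (simp add: cards n_def)
  qed
  moreover have "n0 \<le> int n" by (simp add: n_def k_def)
  moreover have "3 dvd n" by (simp add: n_def)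
  ultimately show ?thesis
    using three_graph_G n
    by (intro exI[of _ n] exI[of _ G]) (simp add: hgraph_order_def t_def)
qed

end
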